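(* For $i=1,2$, let $(E_i,\tau_i)$ be a locally solid Riesz space. (i) If for each $i=1,2$ the space $(E_i,\tau_i)$ has an order bounded $\tau_i$-neighborhood of zero, then $\mathcal{L}_{b}(E_1,E_2)=\mathcal{L}_{tb}(E_1,E_2)$. (ii) If the hypothesis of (i) holds and $E_2$ is also Dedekind complete, then $\mathcal{L}_{b}(E_1,E_2)=\mathcal{L}_{r}(E_1,E_2)=\mathcal{L}_{tb}(E_1,E_2)$. (iii) If for each $i=1,2$ the positive cone $E_i^+$ has nonempty $\tau_i$-interior, then $\mathcal{L}_{b}(E_1,E_2)=\mathcal{L}_{tb}(E_1,E_2)$. (iv) If the hypothesis of (iii) holds and $E_2$ is also Dedekind complete, then $\mathcal{L}_{b}(E_1,E_2)=\mathcal{L}_{r}(E_1,E_2)=\mathcal{L}_{tb}(E_1,E_2)$.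
   Context: A Riesz space is a real vector lattice $E$, with positive cone $E^+=\{x\in E: x\ge 0\}$. A locally solid Riesz space $(E,\tau)$ is a Riesz space with a linear (vector space) topology $\tau$, not assumed Hausdorff, having a base of neighborhoods of zero consisting of solid sets ($A$ is solid if $|x|\le|y|$ and $y\in A$ imply $x\in A$). A subset is order bounded if it is contained in some order interval $[x,y]=\{z: x\le z\le y\}$; it is $\tau$-bounded (topologically bounded) if it is absorbed by every $\tau$-neighborhood of zero. $E$ is Dedekind complete if every nonempty subset that is bounded above has a supremum. Operators are linear maps $T:E_1\to E_2$. $\mathcal{L}_b(E_1,E_2)$ is the space of order bounded operators (mapping order bounded sets to order bounded sets); $\mathcal{L}_r(E_1,E_2)$ is the space of regular operators (differences of two positive operators, where $T$ is positive if $T(E_1^+)\subset E_2^+$); $\mathcal{L}_{tb}(E_1,E_2)$ is the space of topologically bounded operators (mapping $\tau_1$-bounded sets to $\tau_2$-bounded sets). *)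

theory Defs
  imports "HOL-Analysis.Analysis" "HOL-Library.Lattice_Algebras" "HOL-Library.Lub_Glb"
begin

section \<open>Locally solid Riesz spaces\<close>

class riesz_space = ordered_real_vector + lattice_ab_group_add_abs

definition (in riesz_space) solid :: "'a set \<Rightarrow> bool" where
  "solid A \<longleftrightarrow> (\<forall>x y. \<bar>x\<bar> \<le> \<bar>y\<bar> \<and> y \<in> A \<longrightarrow> x \<in> A)"

text \<open>A Riesz space with a linear topology, given by the class operation \<open>open\<close>; no separation
  axiom is imposed. Continuity of addition is part of \<open>topological_ab_group_add\<close>; the axiom
  adds joint continuity of scalar multiplication.\<close>

class topological_riesz_space = riesz_space + topological_ab_group_add +
  assumes tendsto_scaleR_Pair:
    "LIM p (nhds c \<times>\<^sub>F nhds x). fst p *\<^sub>R snd p :> nhds (c *\<^sub>R x)"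

text \<open>Neighborhoods need not be open.\<close>

definition (in topological_riesz_space) zero_nbhd :: "'a set \<Rightarrow> bool" where
  "zero_nbhd U \<longleftrightarrow> (\<exists>S. open S \<and> 0 \<in> S \<and> S \<subseteq> U)"

class locally_solid_riesz_space = topological_riesz_space +
  assumes solid_base: "zero_nbhd U \<Longrightarrow> \<exists>V. zero_nbhd V \<and> solid V \<and> V \<subseteq> U"

definition dedekind_complete :: "'a::riesz_space itself \<Rightarrow> bool" where
  "dedekind_complete _ \<longleftrightarrow>
     (\<forall>A::'a set. A \<noteq> {} \<and> bdd_above A \<longrightarrow> (\<exists>s. isLub UNIV A s))"

section \<open>Bounded sets\<close>

definition order_bounded :: "'a::riesz_space set \<Rightarrow> bool" where
  "order_bounded A \<longleftrightarrow> (\<exists>x y. A \<subseteq> {x..y})"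

definition absorbs :: "'a::real_vector set \<Rightarrow> 'a set \<Rightarrow> bool" where
  "absorbs U A \<longleftrightarrow> (\<exists>r>0. \<forall>c::real. r \<le> \<bar>c\<bar> \<longrightarrow> A \<subseteq> (\<lambda>x. c *\<^sub>R x) ` U)"

definition top_bounded :: "'a::locally_solid_riesz_space set \<Rightarrow> bool" where
  "top_bounded A \<longleftrightarrow> (\<forall>U. zero_nbhd U \<longrightarrow> absorbs U A)"

section \<open>Spaces of operators\<close>

definition positive_operator :: "('a::riesz_space \<Rightarrow> 'b::riesz_space) \<Rightarrow> bool" where
  "positive_operator T \<longleftrightarrow> linear T \<and> T ` {0..} \<subseteq> {0..}"

definition order_bounded_operators :: "('a::riesz_space \<Rightarrow> 'b::riesz_space) set" where
  "order_bounded_operators =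
     {T. linear T \<and> (\<forall>A. order_bounded A \<longrightarrow> order_bounded (T ` A))}"

definition regular_operators :: "('a::riesz_space \<Rightarrow> 'b::riesz_space) set" where
  "regular_operators =
     {T. \<exists>P Q. positive_operator P \<and> positive_operator Q \<and> T = (\<lambda>x. P x - Q x)}"

definition top_bounded_operators ::
    "('a::locally_solid_riesz_space \<Rightarrow> 'b::locally_solid_riesz_space) set" where
  "top_bounded_operators =
     {T. linear T \<and> (\<forall>A. top_bounded A \<longrightarrow> top_bounded (T ` A))}"

end

theory Submission
  imports Defs
begin

text \<open>
  Parts (i) and (iii) hold because, under their hypotheses, the two kinds of bounded sets coincide
  in each space, so that both classes of operators preserve the same bounded sets.
  Every order bounded set is topologically bounded: an order interval lies in some
  \<open>{- z..z}\<close>, small multiples of \<open>z\<close> enter any neighborhood of zero, and a solid neighborhood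
  that contains \<open>t *\<^sub>R z\<close> contains \<open>{- t *\<^sub>R z..t *\<^sub>R z}\<close>
  (lemma \<open>order_bounded_imp_top_bounded\<close>). Conversely, a topologically bounded set is contained in a
  multiple of any neighborhood of zero, hence is order bounded as soon as one such neighborhood
  is (lemma \<open>top_bounded_imp_order_bounded\<close>). An interior point \<open>e\<close> of the positive cone supplies
  such a neighborhood: a solid \<open>W\<close> with \<open>e + W \<subseteq> {0..}\<close> satisfies \<open>W \<subseteq> {- e..e}\<close>, because \<open>W = - W\<close>.

  Parts (ii) and (iv) add the Riesz--Kantorovich theorem. For an order bounded operator \<open>T\<close> into a
  Dedekind complete space, \<open>S x = sup (T ` {0..x})\<close> exists for \<open>x \<ge> 0\<close>. The Riesz decomposition
  property makes \<open>S\<close> additive on the cone, so \<open>S\<close> extends to a linear operator \<open>P\<close>; both \<open>P\<close> and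
  \<open>P - T\<close> are positive, whence \<open>T = P - (P - T)\<close> is regular.
\<close>

section \<open>Order bounded and topologically bounded sets\<close>

lemma order_bounded_iff_symmetric_interval:
  fixes A :: "'a::riesz_space set"
  shows "order_bounded A \<longleftrightarrow> (\<exists>z. A \<subseteq> {- z..z})"
proof
  assume "order_bounded A"
  then obtain x y where A: "A \<subseteq> {x..y}"
    unfolding order_bounded_def by blast
  have "- sup y (- x) \<le> x"
    using sup_ge2[of "- x" y] by (simp add: minus_le_iff)
  then have "{x..y} \<subseteq> {- sup y (- x)..sup y (- x)}"
    by (meson atLeastatMost_subset_iff sup_ge1)
  with A show "\<exists>z. A \<subseteq> {- z..z}"
    by blast
qed (auto simp: order_bounded_def)

lemma zero_nbhd_small_multiples:
  fixes z :: "'a::topological_riesz_space"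
  assumes "zero_nbhd V"
  obtains d :: real where "d > 0" and "\<And>t. \<bar>t\<bar> < d \<Longrightarrow> t *\<^sub>R z \<in> V"
proof -
  from assms obtain S where S: "open S" "0 \<in> S" "S \<subseteq> V"
    unfolding zero_nbhd_def by blast
  have "filterlim (\<lambda>t. (t, z)) (nhds 0 \<times>\<^sub>F nhds z) (nhds (0::real))"
    by (intro filterlim_Pair filterlim_ident tendsto_const)
  from filterlim_compose[OF tendsto_scaleR_Pair this]
  have "((\<lambda>t. t *\<^sub>R z) \<longlongrightarrow> 0) (nhds (0::real))"
    by simp
  then have "\<forall>\<^sub>F t in nhds (0::real). t *\<^sub>R z \<in> S"
    using S by (simp add: tendsto_def)
  then show ?thesis
    using that S by (auto simp: eventually_nhds_metric dist_real_def)
qed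

text \<open>A multiple \<open>\<bar>c\<bar>\<^sup>-\<^sup>1 z\<close> in a solid neighborhood forces \<open>c\<^sup>-\<^sup>1 w\<close> into it for every
  \<open>w \<in> {- z..z}\<close> at once, so the whole interval is absorbed as soon as \<open>z\<close> is.\<close>

lemma order_bounded_imp_top_bounded:
  fixes A :: "'a::locally_solid_riesz_space set"
  assumes "order_bounded A"
  shows "top_bounded A"
  unfolding top_bounded_def
proof (intro allI impI)
  fix U :: "'a set"
  assume "zero_nbhd U"
  then obtain V where V: "zero_nbhd V" "solid V" "V \<subseteq> U"
    using solid_base by blast
  from assms obtain z where z: "A \<subseteq> {- z..z}"
    unfolding order_bounded_iff_symmetric_interval by blast
  obtain d :: real where d: "d > 0" "\<And>t. \<bar>t\<bar> < d \<Longrightarrow> t *\<^sub>R z \<in> V"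
    using zero_nbhd_small_multiples[OF V(1)] by blast
  show "absorbs U A"
    unfolding absorbs_def
    \<comment> \<open>The factor 2 turns \<open>2 / d \<le> \<bar>c\<bar>\<close> into the strict bound \<open>1 / \<bar>c\<bar> < d\<close>.\<close>
  proof (intro exI[of _ "2 / d"] conjI allI impI subsetI)
    fix c :: real and w
    assume c: "2 / d \<le> \<bar>c\<bar>" and "w \<in> A"
    have pos: "0 < 2 / d"
      using d by simp
    with c have c0: "\<bar>c\<bar> > 0"
      by linarith
    have "inverse \<bar>c\<bar> \<le> inverse (2 / d)"
      using le_imp_inverse_le[OF c pos] .
    then have "\<bar>inverse \<bar>c\<bar>\<bar> < d"
      using d(1) by simp
    then have inV: "inverse \<bar>c\<bar> *\<^sub>R z \<in> V"
      by (rule d(2))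
    have w: "- z \<le> w" "w \<le> z" "- w \<le> z"
      using z \<open>w \<in> A\<close> by (auto simp: minus_le_iff)
    have up: "inverse \<bar>c\<bar> *\<^sub>R w \<le> inverse \<bar>c\<bar> *\<^sub>R z"
      "- (inverse \<bar>c\<bar> *\<^sub>R w) \<le> inverse \<bar>c\<bar> *\<^sub>R z"
      using scaleR_left_mono[OF w(2), of "inverse \<bar>c\<bar>"]
        scaleR_left_mono[OF w(3), of "inverse \<bar>c\<bar>"] by auto
    have "\<bar>inverse c *\<^sub>R w\<bar> \<le> inverse \<bar>c\<bar> *\<^sub>R z"
      using up by (cases "c \<ge> 0") (auto intro!: abs_leI)
    also have "\<dots> \<le> \<bar>inverse \<bar>c\<bar> *\<^sub>R z\<bar>"
      by (rule abs_ge_self)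
    finally have "inverse c *\<^sub>R w \<in> V"
      using V(2) inV unfolding solid_def by blast
    moreover have "w = c *\<^sub>R (inverse c *\<^sub>R w)"
      using c0 by simp
    ultimately show "w \<in> (\<lambda>x. c *\<^sub>R x) ` U"
      using V(3) by blast
  qed (use d in simp)
qed

lemma top_bounded_imp_order_bounded:
  fixes A U :: "'a::locally_solid_riesz_space set"
  assumes "zero_nbhd U" and "order_bounded U" and "top_bounded A"
  shows "order_bounded A"
proof -
  from assms obtain r :: real where r: "r > 0" "A \<subseteq> (\<lambda>x. r *\<^sub>R x) ` U"
    unfolding top_bounded_def absorbs_def by (metis abs_of_pos order_refl)
  from assms obtain x y where "U \<subseteq> {x..y}"
    unfolding order_bounded_def by blast
  then have "A \<subseteq> {r *\<^sub>R x..r *\<^sub>R y}"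
    using r by (fastforce intro: scaleR_left_mono)
  then show ?thesis
    unfolding order_bounded_def by blast
qed

lemma order_bounded_operators_eq_top_bounded_operators:
  assumes "\<exists>U::'a::locally_solid_riesz_space set. zero_nbhd U \<and> order_bounded U"
    and "\<exists>V::'b::locally_solid_riesz_space set. zero_nbhd V \<and> order_bounded V"
  shows "(order_bounded_operators :: ('a \<Rightarrow> 'b) set) = top_bounded_operators"
proof -
  have "order_bounded A \<longleftrightarrow> top_bounded A" for A :: "'a set"
    using assms(1) order_bounded_imp_top_bounded top_bounded_imp_order_bounded by blast
  moreover have "order_bounded A \<longleftrightarrow> top_bounded A" for A :: "'b set"
    using assms(2) order_bounded_imp_top_bounded top_bounded_imp_order_bounded by blast
  ultimately show ?thesis
    unfolding order_bounded_operators_def top_bounded_operators_def by simp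
qed

text \<open>If \<open>e\<close> is interior to the cone, then \<open>e + w\<close> and \<open>e - w\<close> are positive for all \<open>w\<close> in a
  small solid neighborhood of zero, which is therefore contained in \<open>{- e..e}\<close>.\<close>

lemma interior_cone_imp_order_bounded_nbhd:
  assumes "interior {0::'a::locally_solid_riesz_space..} \<noteq> {}"
  shows "\<exists>U::'a set. zero_nbhd U \<and> order_bounded U"
proof -
  obtain e :: 'a where e: "e \<in> interior {0..}"
    using assms by blast
  have "open ((\<lambda>w. e + w) -` interior {0..})"
    by (intro open_vimage open_interior continuous_intros)
  with e have "zero_nbhd ((\<lambda>w. e + w) -` interior {0..})"
    unfolding zero_nbhd_def by (intro exI[of _ "(\<lambda>w. e + w) -` interior {0..}"]) auto
  then obtain W where W: "zero_nbhd W" "solid W" "W \<subseteq> (\<lambda>w. e + w) -` interior {0..}"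
    using solid_base by blast
  have "w \<in> {- e..e}" if "w \<in> W" for w
  proof -
    have "\<bar>- w\<bar> \<le> \<bar>w\<bar>"
      by simp
    then have "- w \<in> W"
      using W(2) that unfolding solid_def by blast
    with that W(3) have "e + w \<in> interior {0..}" "e + - w \<in> interior {0..}"
      by blast+
    then have "0 \<le> e + w" "0 \<le> e - w"
      using interior_subset[of "{0::'a..}"] by auto
    moreover have "- e \<le> w \<longleftrightarrow> 0 \<le> e + w"
      by (metis add.commute diff_minus_eq_add diff_ge_0_iff_ge)
    ultimately show ?thesis
      by simp
  qed
  then have "order_bounded W"
    unfolding order_bounded_def by blast
  with W show ?thesis
    by blast
qed

section \<open>The Riesz--Kantorovich theorem\<close>

text \<open>The Riesz decomposition property, with the explicit summands \<open>inf z x\<close> and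
  \<open>z - inf z x = sup 0 (z - x)\<close>.\<close>

lemma riesz_decomposition:
  fixes x y z :: "'a::riesz_space"
  assumes "0 \<le> x" and "0 \<le> y" and "0 \<le> z" and "z \<le> x + y"
  obtains u v where "z = u + v" and "u \<in> {0..x}" and "v \<in> {0..y}"
proof
  show "z = inf z x + (z - inf z x)"
    by (metis add.commute diff_add_cancel)
  show "inf z x \<in> {0..x}"
    using assms by simp
  have "z - y \<le> x"
    using assms by (simp add: diff_le_eq)
  moreover have "z - y \<le> z"
    using assms by (simp add: diff_le_eq)
  ultimately have "z - y \<le> inf z x"
    by simp
  then have "z - inf z x \<le> y"
    by (metis add.commute diff_le_eq)
  moreover have "0 \<le> z - inf z x"
    by (simp only: diff_ge_0_iff_ge inf_le1)
  ultimately show "z - inf z x \<in> {0..y}"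
    by (simp only: atLeastAtMost_iff)
qed

text \<open>Decomposition turns the supremum over \<open>{0..x + y}\<close> that will define \<open>S (x + y)\<close> into
  the supremum of a set sum, which splits as \<open>S x + S y\<close>.\<close>

lemma image_interval_add:
  fixes T :: "'a::riesz_space \<Rightarrow> 'b::riesz_space"
  assumes "linear T" and "0 \<le> x" and "0 \<le> y"
  shows "T ` {0..x + y} = {a + b |a b. a \<in> T ` {0..x} \<and> b \<in> T ` {0..y}}"
proof
  show "T ` {0..x + y} \<subseteq> {a + b |a b. a \<in> T ` {0..x} \<and> b \<in> T ` {0..y}}"
  proof
    fix t
    assume "t \<in> T ` {0..x + y}"
    then obtain z where z: "t = T z" "0 \<le> z" "z \<le> x + y"
      by auto
    obtain u v where uv: "z = u + v" "u \<in> {0..x}" "v \<in> {0..y}"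
      using riesz_decomposition[OF assms(2,3) z(2,3)] by blast
    have "t = T u + T v"
      using linear_add[OF assms(1)] z(1) uv(1) by simp
    with uv show "t \<in> {a + b |a b. a \<in> T ` {0..x} \<and> b \<in> T ` {0..y}}"
      by blast
  qed
  show "{a + b |a b. a \<in> T ` {0..x} \<and> b \<in> T ` {0..y}} \<subseteq> T ` {0..x + y}"
  proof clarify
    fix u v
    assume "u \<in> {0..x}" "v \<in> {0..y}"
    then have "u + v \<in> {0..x + y}"
      by (auto intro: add_mono)
    then show "T u + T v \<in> T ` {0..x + y}"
      using linear_add[OF assms(1)] by (metis imageI)
  qed
qed

lemma image_interval_scaleR:
  fixes T :: "'a::riesz_space \<Rightarrow> 'b::riesz_space"
  assumes "linear T" and "c > 0"
  shows "T ` {0..c *\<^sub>R x} = (\<lambda>a. c *\<^sub>R a) ` T ` {0..x}"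
proof
  show "T ` {0..c *\<^sub>R x} \<subseteq> (\<lambda>a. c *\<^sub>R a) ` T ` {0..x}"
  proof clarify
    fix z
    assume "z \<in> {0..c *\<^sub>R x}"
    then have "inverse c *\<^sub>R z \<in> {0..x}"
      using assms(2) scaleR_left_mono[of z "c *\<^sub>R x" "inverse c"]
      by (auto intro: scaleR_nonneg_nonneg)
    moreover have "T z = c *\<^sub>R T (inverse c *\<^sub>R z)"
      using assms by (simp flip: linear_scale)
    ultimately show "T z \<in> (\<lambda>a. c *\<^sub>R a) ` T ` {0..x}"
      by blast
  qed
  show "(\<lambda>a. c *\<^sub>R a) ` T ` {0..x} \<subseteq> T ` {0..c *\<^sub>R x}"
  proof clarify
    fix z
    assume "z \<in> {0..x}"
    then have "c *\<^sub>R z \<in> {0..c *\<^sub>R x}"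
      using assms(2) by (auto intro: scaleR_left_mono scaleR_nonneg_nonneg)
    then show "c *\<^sub>R T z \<in> T ` {0..c *\<^sub>R x}"
      using linear_scale[OF assms(1)] by (metis imageI)
  qed
qed

lemma isLub_UNIV_iff:
  "isLub UNIV A s \<longleftrightarrow> (\<forall>a\<in>A. a \<le> s) \<and> (\<forall>u. (\<forall>a\<in>A. a \<le> u) \<longrightarrow> s \<le> u)"
  by (auto simp: isLub_def leastP_def isUb_def setle_def setge_def)

text \<open>An upper bound \<open>u\<close> of all sums \<open>a + b\<close> dominates \<open>s + t\<close> because, for each fixed \<open>b\<close>, the element
  \<open>u - b\<close> bounds \<open>A\<close>, so \<open>u - s\<close> in turn bounds \<open>B\<close>.\<close>

lemma isLub_set_sum:
  fixes s t :: "'a::ordered_ab_group_add"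
  assumes s: "isLub UNIV A s" and t: "isLub UNIV B t"
  shows "isLub UNIV {a + b |a b. a \<in> A \<and> b \<in> B} (s + t)"
  unfolding isLub_UNIV_iff
proof (intro conjI ballI allI impI)
  fix c
  assume "c \<in> {a + b |a b. a \<in> A \<and> b \<in> B}"
  then show "c \<le> s + t"
    using s t by (auto simp: isLub_UNIV_iff intro: add_mono)
next
  fix u
  assume u: "\<forall>c\<in>{a + b |a b. a \<in> A \<and> b \<in> B}. c \<le> u"
  have "s \<le> u - b" if "b \<in> B" for b
  proof -
    have "\<forall>a\<in>A. a \<le> u - b"
      using u that by (auto simp: le_diff_eq)
    then show ?thesis
      using s by (auto simp: isLub_UNIV_iff)
  qed
  then have "\<forall>b\<in>B. b \<le> u - s"
    by (auto simp: le_diff_eq add.commute)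
  then have "t \<le> u - s"
    using t by (auto simp: isLub_UNIV_iff)
  then show "s + t \<le> u"
    by (simp add: le_diff_eq add.commute)
qed

lemma isLub_scaleR:
  fixes s :: "'a::ordered_real_vector"
  assumes "isLub UNIV A s" and "c > 0"
  shows "isLub UNIV ((\<lambda>a. c *\<^sub>R a) ` A) (c *\<^sub>R s)"
  unfolding isLub_UNIV_iff
proof (intro conjI ballI allI impI)
  fix b
  assume "b \<in> (\<lambda>a. c *\<^sub>R a) ` A"
  then show "b \<le> c *\<^sub>R s"
    using assms by (auto simp: isLub_UNIV_iff intro: scaleR_left_mono)
next
  fix u
  assume "\<forall>b\<in>(\<lambda>a. c *\<^sub>R a) ` A. b \<le> u"
  then have "\<forall>a\<in>A. a \<le> inverse c *\<^sub>R u"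
    using assms(2) by (auto simp: pos_le_divideR_eq)
  then have "s \<le> inverse c *\<^sub>R u"
    using assms(1) by (auto simp: isLub_UNIV_iff)
  then show "c *\<^sub>R s \<le> u"
    using assms(2) by (simp add: pos_le_divideR_eq)
qed

text \<open>The extension is \<open>P x = S x\<^sup>+ - S x\<^sup>-\<close>. Additivity on the cone makes \<open>S u - S v\<close> depend only on
  \<open>u - v\<close>, so any other decomposition of \<open>x\<close> into a difference of positive elements gives the same
  value; linearity follows by choosing convenient decompositions.\<close>

lemma additive_on_cone_extends_linear:
  fixes S :: "'a::riesz_space \<Rightarrow> 'b::real_vector"
  assumes add: "\<And>x y. 0 \<le> x \<Longrightarrow> 0 \<le> y \<Longrightarrow> S (x + y) = S x + S y"
    and scale: "\<And>c x. 0 < c \<Longrightarrow> 0 \<le> x \<Longrightarrow> S (c *\<^sub>R x) = c *\<^sub>R S x"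
  obtains P where "linear P" and "\<And>x. 0 \<le> x \<Longrightarrow> P x = S x"
proof
  define P where "P x = S (sup x 0) - S (sup (- x) 0)" for x
  have parts: "sup x 0 - sup (- x) 0 = x" for x :: 'a
    using prts[of x] by (simp add: pprt_def nprt_def neg_inf_eq_sup)
  have diff: "P (u - v) = S u - S v" if "0 \<le> u" "0 \<le> v" for u v
  proof -
    let ?p = "sup (u - v) 0" and ?n = "sup (- (u - v)) 0"
    have "a + d = b + c" if "a - b = c - d" for a b c d :: 'a
      using that by (simp add: algebra_simps)
    from this[OF parts[of "u - v"]] have "?p + v = ?n + u" .
    then have "S (?p + v) = S (?n + u)"
      by simp
    then have "S ?p + S v = S ?n + S u"
      using that by (simp add: add)
    then show ?thesis
      unfolding P_def by (simp add: algebra_simps)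
  qed
  have S0: "S 0 = 0"
    using add[of 0 0] by simp
  show cone: "P x = S x" if "0 \<le> x" for x
    using diff[of x 0] that S0 by simp
  have P_add: "P (x + y) = P x + P y" for x y
  proof -
    have "x + y = (sup x 0 + sup y 0) - (sup (- x) 0 + sup (- y) 0)"
      by (simp only: add_diff_add parts)
    then have "P (x + y) = S (sup x 0 + sup y 0) - S (sup (- x) 0 + sup (- y) 0)"
      by (simp only: diff add_nonneg_nonneg sup_ge2)
    then show ?thesis
      by (simp add: add P_def)
  qed
  have P_pos: "P (c *\<^sub>R x) = c *\<^sub>R P x" if "c > 0" for c x
  proof -
    have "c *\<^sub>R x = c *\<^sub>R sup x 0 - c *\<^sub>R sup (- x) 0"
      using parts[of x] by (simp flip: scaleR_diff_right)
    then have "P (c *\<^sub>R x) = S (c *\<^sub>R sup x 0) - S (c *\<^sub>R sup (- x) 0)"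
      using that by (simp only: diff scaleR_nonneg_nonneg less_imp_le sup_ge2)
    then show ?thesis
      using that by (simp add: scale P_def scaleR_diff_right)
  qed
  have P_minus: "P (- x) = - P x" for x
    by (simp add: P_def)
  have P_scale: "P (c *\<^sub>R x) = c *\<^sub>R P x" for c x
  proof (cases c "0::real" rule: linorder_cases)
    case less
    then show ?thesis
      using P_pos[of "- c" x] P_minus[of "c *\<^sub>R x"] by simp
  next
    case equal
    then show ?thesis
      using cone[of 0] S0 by simp
  qed (rule P_pos)
  show "linear P"
    by (rule linearI) (rule P_add, rule P_scale)
qed

text \<open>Here \<open>P\<close> is the positive part of \<open>T\<close> in the ordered space of operators. On the cone, \<open>P\<close> dominates
  both \<open>0\<close> and \<open>T\<close>, since \<open>0\<close> and \<open>x\<close> both belong to the interval \<open>{0..x}\<close> over which the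
  supremum is taken.\<close>

lemma order_bounded_imp_regular:
  fixes T :: "'a::riesz_space \<Rightarrow> 'b::riesz_space"
  assumes T: "T \<in> order_bounded_operators" and complete: "dedekind_complete TYPE('b)"
  shows "T \<in> regular_operators"
proof -
  have lin: "linear T"
    using T by (simp add: order_bounded_operators_def)
  define S where "S x = (THE s. isLub UNIV (T ` {0..x}) s)" for x
  have unique: "s = t" if "isLub UNIV A s" "isLub UNIV A t" for A and s t :: 'b
    using that by (auto simp: isLub_UNIV_iff intro: antisym)
  have S: "isLub UNIV (T ` {0..x}) (S x)" if "0 \<le> x" for x
  proof -
    have "order_bounded {0..x}"
      unfolding order_bounded_def by blast
    then have "order_bounded (T ` {0..x})"
      using T by (simp add: order_bounded_operators_def)
    then have "bdd_above (T ` {0..x})"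
      unfolding order_bounded_def by (meson bdd_above_Icc bdd_above_mono)
    moreover have "T ` {0..x} \<noteq> {}"
      using that by auto
    ultimately obtain s where "isLub UNIV (T ` {0..x}) s"
      using complete unfolding dedekind_complete_def by meson
    then show ?thesis
      unfolding S_def by (rule theI) (blast intro: unique \<open>isLub UNIV (T ` {0..x}) s\<close>)
  qed
  have S_ge: "T u \<le> S x" if "0 \<le> u" "u \<le> x" for u x
    using S[of x] that by (auto simp: isLub_UNIV_iff)
  have S_add: "S (x + y) = S x + S y" if "0 \<le> x" "0 \<le> y" for x y
  proof (rule unique)
    show "isLub UNIV (T ` {0..x + y}) (S (x + y))"
      using that by (intro S add_nonneg_nonneg)
    show "isLub UNIV (T ` {0..x + y}) (S x + S y)"
      unfolding image_interval_add[OF lin that] using that by (intro isLub_set_sum S)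
  qed
  have S_scale: "S (c *\<^sub>R x) = c *\<^sub>R S x" if "0 < c" "0 \<le> x" for c x
  proof (rule unique)
    show "isLub UNIV (T ` {0..c *\<^sub>R x}) (S (c *\<^sub>R x))"
      using that by (intro S scaleR_nonneg_nonneg) simp_all
    show "isLub UNIV (T ` {0..c *\<^sub>R x}) (c *\<^sub>R S x)"
      unfolding image_interval_scaleR[OF lin that(1)] using that by (intro isLub_scaleR S)
  qed
  obtain P where P: "linear P" "\<And>x. 0 \<le> x \<Longrightarrow> P x = S x"
    using additive_on_cone_extends_linear[of S] S_add S_scale by blast
  have "positive_operator P"
    unfolding positive_operator_def using P S_ge[of 0] linear_0[OF lin] by auto
  moreover have "positive_operator (\<lambda>x. P x - T x)"
    unfolding positive_operator_def
    using P S_ge linear_compose_sub[OF P(1) lin] by auto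
  moreover have "T = (\<lambda>x. P x - (P x - T x))"
    by simp
  ultimately show ?thesis
    unfolding regular_operators_def by blast
qed

lemma positive_operator_mono:
  assumes "positive_operator P" and "x \<le> y"
  shows "P x \<le> P y"
proof -
  have "linear P" "P ` {0..} \<subseteq> {0..}"
    using assms(1) by (auto simp: positive_operator_def)
  moreover have "y - x \<in> {0..}"
    using assms(2) by simp
  ultimately have "linear P" "0 \<le> P (y - x)"
    by blast+
  then show ?thesis
    by (simp add: linear_diff)
qed

lemma regular_imp_order_bounded:
  fixes T :: "'a::riesz_space \<Rightarrow> 'b::riesz_space"
  assumes "T \<in> regular_operators"
  shows "T \<in> order_bounded_operators"
proof -
  obtain P Q where P: "positive_operator P" and Q: "positive_operator Q"
    and T: "T = (\<lambda>x. P x - Q x)"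
    using assms unfolding regular_operators_def by blast
  have "linear T"
    unfolding T using P Q by (intro linear_compose_sub) (simp_all add: positive_operator_def)
  moreover have "order_bounded (T ` A)" if A: "order_bounded A" for A
  proof -
    obtain x y where "A \<subseteq> {x..y}"
      using A unfolding order_bounded_def by blast
    then have "T ` A \<subseteq> {P x - Q y..P y - Q x}"
      unfolding T by (auto intro!: diff_mono positive_operator_mono[OF P] positive_operator_mono[OF Q])
    then show ?thesis
      unfolding order_bounded_def by blast
  qed
  ultimately show ?thesis
    by (simp add: order_bounded_operators_def)
qed

lemma riesz_kantorovich:
  assumes "dedekind_complete TYPE('b::riesz_space)"
  shows "(order_bounded_operators :: ('a::riesz_space \<Rightarrow> 'b) set) = regular_operators"
  using order_bounded_imp_regular[OF _ assms] regular_imp_order_bounded by blast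

section \<open>Coincidence of the classes of operators\<close>

theorem theorem3p1:
  fixes Lb Lr Ltb ::
    "('a::locally_solid_riesz_space \<Rightarrow> 'b::locally_solid_riesz_space) set"
  defines "Lb \<equiv> order_bounded_operators"
    and "Lr \<equiv> regular_operators"
    and "Ltb \<equiv> top_bounded_operators"
  shows
    "((\<exists>U::'a set. zero_nbhd U \<and> order_bounded U) \<and>
      (\<exists>V::'b set. zero_nbhd V \<and> order_bounded V)
        \<longrightarrow> Lb = Ltb) \<and>
     ((\<exists>U::'a set. zero_nbhd U \<and> order_bounded U) \<and>
      (\<exists>V::'b set. zero_nbhd V \<and> order_bounded V) \<and> dedekind_complete TYPE('b)
        \<longrightarrow> Lb = Lr \<and> Lr = Ltb) \<and>
     (interior {0::'a..} \<noteq> {} \<and> interior {0::'b..} \<noteq> {}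
        \<longrightarrow> Lb = Ltb) \<and>
     (interior {0::'a..} \<noteq> {} \<and> interior {0::'b..} \<noteq> {} \<and> dedekind_complete TYPE('b)
        \<longrightarrow> Lb = Lr \<and> Lr = Ltb)"
  unfolding Lb_def Lr_def Ltb_def
  using order_bounded_operators_eq_top_bounded_operators[where 'a='a and 'b='b]
    riesz_kantorovich[where 'a='a and 'b='b]
    interior_cone_imp_order_bounded_nbhd[where 'a='a]
    interior_cone_imp_order_bounded_nbhd[where 'a='b]
  by metis

end
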